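(* Let $G^*$ be a $(k,r)$-regular hypergraph with $n$ vertices whose adjacency spectrum (eigenvalues of the adjacency matrix listed with multiplicity) is $\lambda_1=r(k-1),\lambda_2,\lambda_3,\dots,\lambda_n$. Then the Seidel spectrum of $G^*$ (eigenvalues of the Seidel matrix listed with multiplicity) is $$n-1-2\lambda_1,\ -1-2\lambda_2,\ -1-2\lambda_3,\ \dots,\ -1-2\lambda_n.$$
   Context: A hypergraph $G^*=(V,E)$ of order $n$ has a finite vertex set $V=\{v_1,\dots,v_n\}$ and a finite set $E$ of hyperedges, each a subset of $V$. It is $k$-uniform ($k\ge2$) if every hyperedge has cardinality $k$, $r$-regular if every vertex lies in exactly $r$ hyperedges, and $(k,r)$-regular if it is both. Its adjacency matrix $A=(a_{ij})$ has $a_{ij}=|\{e\in E:\{v_i,v_j\}\subset e\}|$ for $i\ne j$ and $a_{ii}=0$. Its Seidel matrix is $S=J_n-I_n-2A$, where $J_n$ is the all-ones matrix and $I_n$ the identity matrix of order $n$. For a $(k,r)$-regular hypergraph, $r(k-1)$ is an eigenvalue of $A$. *)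

theory Defs
  imports Complex_Main "Jordan_Normal_Form.Char_Poly"
begin

definition hypergraph :: "'a set \<Rightarrow> 'a set set \<Rightarrow> bool" where
  "hypergraph V E \<longleftrightarrow> finite V \<and> finite E \<and> (\<forall>e\<in>E. e \<subseteq> V)"

definition uniform_hypergraph :: "'a set set \<Rightarrow> nat \<Rightarrow> bool" where
  "uniform_hypergraph E k \<longleftrightarrow> k \<ge> 2 \<and> (\<forall>e\<in>E. card e = k)"

definition regular_hypergraph :: "'a set \<Rightarrow> 'a set set \<Rightarrow> nat \<Rightarrow> bool" where
  "regular_hypergraph V E r \<longleftrightarrow> (\<forall>v\<in>V. card {e \<in> E. v \<in> e} = r)"

text \<open>The vertices are indexed by an enumeration \<open>vs\<close>: the list without repetitions
  \<open>v\<^sub>1, \<dots>, v\<^sub>n\<close> of the vertex set (positions counted from 0).\<close>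

definition adjacency_mat :: "'a list \<Rightarrow> 'a set set \<Rightarrow> real mat" where
  "adjacency_mat vs E = mat (length vs) (length vs)
     (\<lambda>(i, j). if i = j then 0 else real (card {e \<in> E. {vs ! i, vs ! j} \<subseteq> e}))"

definition all_ones_mat :: "nat \<Rightarrow> real mat" where
  "all_ones_mat n = mat n n (\<lambda>_. 1)"

definition seidel_mat :: "'a list \<Rightarrow> 'a set set \<Rightarrow> real mat" where
  "seidel_mat vs E =
     all_ones_mat (length vs) - 1\<^sub>m (length vs) - 2 \<cdot>\<^sub>m adjacency_mat vs E"

text \<open>The eigenvalues with multiplicity are taken in the complex numbers, so that the multiset
  of a real matrix of order \<open>n\<close> always has \<open>n\<close> elements.\<close>

definition eigenvalue_mset :: "real mat \<Rightarrow> complex multiset" where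
  "eigenvalue_mset A = proots (char_poly (map_mat complex_of_real A))"

end

theory Submission
  imports Defs "Jordan_Normal_Form.Schur_Decomposition"
begin

text \<open>Regularity makes the all-ones vector a common eigenvector of \<open>A\<close>, \<open>I\<close> and \<open>J\<close>. Splitting it off
  by one change of basis kills \<open>J\<close> on the quotient, so there \<open>S\<close> acts as \<open>- I - 2 A\<close>, whose
  eigenvalues are read off a triangularization of \<open>A\<close>.\<close>

text \<open>A change of basis that triangularizes \<open>A\<close> also triangularizes
  \<open>a I + b A\<close>, sending each diagonal entry \<open>x\<close> to
  \<open>a + b * x\<close>. Triangular form, unlike diagonalization, keeps multiplicities for every
  complex matrix.\<close>

lemma char_poly_affine:
  fixes A :: "complex mat"
  assumes A: "A \<in> carrier_mat n n"
    and cp: "char_poly A = (\<Prod>x\<leftarrow>xs. [:- x, 1:])"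
  shows "char_poly (a \<cdot>\<^sub>m 1\<^sub>m n + b \<cdot>\<^sub>m A) = (\<Prod>x\<leftarrow>xs. [:- (a + b * x), 1:])"
proof -
  obtain B P Q where BPQ: "schur_decomposition A xs = (B, P, Q)"
    by (metis prod_cases3)
  from schur_decomposition[OF A cp BPQ]
  have sim: "similar_mat_wit A B P Q" and ut: "upper_triangular B" and diag: "diag_mat B = xs"
    by auto
  note s = similar_mat_witD2[OF A sim]
  have "a \<cdot>\<^sub>m 1\<^sub>m n = P * (a \<cdot>\<^sub>m 1\<^sub>m n) * Q"
    using s by (simp add: mult_smult_distrib[of _ n n _ n] mult_smult_assoc_mat[of _ n n _ n])
  moreover have "b \<cdot>\<^sub>m A = P * (b \<cdot>\<^sub>m B) * Q"
    using similar_mat_witD2(3)[OF _ similar_mat_wit_smult[OF sim]] A by fastforce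
  ultimately have "a \<cdot>\<^sub>m 1\<^sub>m n + b \<cdot>\<^sub>m A = P * (a \<cdot>\<^sub>m 1\<^sub>m n) * Q + P * (b \<cdot>\<^sub>m B) * Q"
    by simp
  also have "\<dots> = P * (a \<cdot>\<^sub>m 1\<^sub>m n + b \<cdot>\<^sub>m B) * Q"
    using s(5-7) by (simp add: mult_add_distrib_mat[of _ n n _ n] add_mult_distrib_mat[of _ n n _ _ n])
  finally have "similar_mat (a \<cdot>\<^sub>m 1\<^sub>m n + b \<cdot>\<^sub>m A) (a \<cdot>\<^sub>m 1\<^sub>m n + b \<cdot>\<^sub>m B)"
    using s by (intro similar_matI[of _ _ P Q n]) auto
  from char_poly_similar[OF this]
  have "char_poly (a \<cdot>\<^sub>m 1\<^sub>m n + b \<cdot>\<^sub>m A) = char_poly (a \<cdot>\<^sub>m 1\<^sub>m n + b \<cdot>\<^sub>m B)" .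
  also have "\<dots> = (\<Prod>x \<leftarrow> diag_mat (a \<cdot>\<^sub>m 1\<^sub>m n + b \<cdot>\<^sub>m B). [:- x, 1:])"
    using s(5) ut by (intro char_poly_upper_triangular[of _ n]) (auto simp: upper_triangularD)
  also have "diag_mat (a \<cdot>\<^sub>m 1\<^sub>m n + b \<cdot>\<^sub>m B) = map (\<lambda>x. a + b * x) (diag_mat B)"
    using s(5) by (auto simp: diag_mat_def)
  finally show ?thesis
    by (simp add: diag o_def)
qed

text \<open>When all row sums agree, this is the matrix of the map that \<open>A\<close> induces on
  the quotient by the all-ones vector, in the basis of the images of all standard basis vectors but
  the first.\<close>

definition deflate_mat :: "'a::minus mat \<Rightarrow> 'a mat" where
  "deflate_mat A = mat (dim_row A - 1) (dim_col A - 1)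
     (\<lambda>(i, j). A $$ (Suc i, Suc j) - A $$ (0, Suc j))"

text \<open>If all rows of \<open>A\<close> have sum \<open>s\<close>, then replacing the first basis vector by the all-ones
  vector turns \<open>A\<close> into the block matrix with first column \<open>(s, 0, \<dots>, 0)\<close> and lower right
  block \<open>deflate_mat A\<close>.\<close>

lemma char_poly_constant_row_sum:
  fixes A :: "'a::field mat"
  assumes A: "A \<in> carrier_mat (Suc m) (Suc m)"
    and row_sum: "\<And>i. i < Suc m \<Longrightarrow> (\<Sum>j<Suc m. A $$ (i, j)) = s"
  shows "char_poly A = [:- s, 1:] * char_poly (deflate_mat A)"
proof -
  let ?n = "Suc m"
  \<comment> \<open>The columns of \<open>P\<close> are the new basis: the all-ones vector, then the
    standard basis vectors other than the first. \<open>Q\<close> is its inverse.\<close>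
  define P :: "'a mat" where "P = mat ?n ?n (\<lambda>(i, j). if j = 0 \<or> i = j then 1 else 0)"
  define Q :: "'a mat" where
    "Q = mat ?n ?n (\<lambda>(i, j). if i = j then 1 else if j = 0 then - 1 else 0)"
  define B where "B = four_block_mat (mat 1 1 (\<lambda>_. s)) (mat 1 m (\<lambda>(_, j). A $$ (0, Suc j)))
    (0\<^sub>m m 1) (deflate_mat A)"
  have D: "deflate_mat A \<in> carrier_mat m m"
    using A by (auto simp: deflate_mat_def)
  have PQ: "P \<in> carrier_mat ?n ?n" "Q \<in> carrier_mat ?n ?n" "B \<in> carrier_mat ?n ?n"
    using D by (auto simp: P_def Q_def B_def)
  have P_mult: "(P * X) $$ (i, j) = (if i = 0 then 0 else X $$ (i, j)) + X $$ (0, j)"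
    if X: "X \<in> carrier_mat ?n ?n" and "i < ?n" "j < ?n" for X i j
  proof -
    have "(P * X) $$ (i, j) = (\<Sum>l<?n. (if l = 0 \<or> i = l then 1 else 0) * X $$ (l, j))"
      using that by (auto simp: P_def scalar_prod_def lessThan_atLeast0 intro!: sum.cong)
    also have "\<dots> = X $$ (0, j) + (\<Sum>l<m. (if i = Suc l then X $$ (i, j) else 0))"
      unfolding sum.lessThan_Suc_shift by (auto intro!: sum.cong)
    also have "\<dots> = (if i = 0 then 0 else X $$ (i, j)) + X $$ (0, j)"
      using that by (cases i) auto
    finally show ?thesis .
  qed
  \<comment> \<open>Right multiplication by \<open>P\<close> replaces the first column by the row
    sums, which is how \<open>s\<close> enters.\<close>
  have mult_P: "(X * P) $$ (i, j) = (if j = 0 then (\<Sum>l<?n. X $$ (i, l)) else X $$ (i, j))"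
    if X: "X \<in> carrier_mat ?n ?n" and "i < ?n" "j < ?n" for X i j
  proof -
    have "(X * P) $$ (i, j) = (\<Sum>l<?n. X $$ (i, l) * (if j = 0 \<or> l = j then 1 else 0))"
      using that by (auto simp: P_def scalar_prod_def lessThan_atLeast0 intro!: sum.cong)
    also have "\<dots> = (if j = 0 then (\<Sum>l<?n. X $$ (i, l)) else X $$ (i, j))"
      using that by (auto simp: if_distrib[of "\<lambda>x. _ * x"] cong: if_cong)
    finally show ?thesis .
  qed
  have PQ1: "P * Q = 1\<^sub>m ?n"
    by (rule eq_matI) (use PQ in \<open>auto simp: P_mult simp del: index_mult_mat(1), auto simp: Q_def\<close>)
  have QP1: "Q * P = 1\<^sub>m ?n"
    using mat_mult_left_right_inverse[OF PQ(1,2) PQ1] .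
  \<comment> \<open>Left multiplication by \<open>P\<close> adds row 0 to all later rows, undoing
    the subtraction in \<open>deflate_mat\<close>.\<close>
  have AP: "A * P = P * B"
  proof (rule eq_matI)
    fix i j assume "i < dim_row (P * B)" "j < dim_col (P * B)"
    hence ij: "i < ?n" "j < ?n" using PQ by auto
    have "(A * P) $$ (i, j) = (if j = 0 then s else A $$ (i, j))"
      using mult_P[OF A ij] row_sum[OF ij(1)] by simp
    also have "\<dots> = (P * B) $$ (i, j)"
      unfolding P_mult[OF PQ(3) ij] using ij A
      by (cases i; cases j) (auto simp: B_def deflate_mat_def)
    finally show "(A * P) $$ (i, j) = (P * B) $$ (i, j)" .
  qed (use A PQ in auto)
  have "A = A * (P * Q)"
    using A by (simp add: PQ1)
  also have "\<dots> = A * P * Q"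
    using A PQ by (simp add: assoc_mult_mat[of _ ?n ?n _ ?n _ ?n])
  finally have "similar_mat A B"
    using A PQ PQ1 QP1 by (intro similar_matI[of _ _ P Q ?n]) (auto simp: AP)
  hence "char_poly A = char_poly B"
    by (rule char_poly_similar)
  also have "\<dots> = char_poly (mat 1 1 (\<lambda>_. s)) * char_poly (deflate_mat A)"
    unfolding B_def by (rule char_poly_four_block_zeros_col) (use D in auto)
  also have "char_poly (mat 1 1 (\<lambda>_. s)) = [:- s, 1:]"
    by (subst char_poly_upper_triangular[of _ 1]) (auto simp: diag_mat_def)
  finally show ?thesis .
qed

text \<open>Double counting of the pairs of a vertex \<open>w\<close> other than
  \<open>vs ! i\<close> and a hyperedge containing both: each of the \<open>r\<close> hyperedges
  through \<open>vs ! i\<close> has \<open>k - 1\<close> further vertices.\<close>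

lemma adjacency_mat_row_sum:
  assumes hyp: "hypergraph V E"
    and unif: "uniform_hypergraph E k"
    and reg: "regular_hypergraph V E r"
    and vs: "distinct vs" "set vs = V"
    and i: "i < length vs"
  shows "(\<Sum>j<length vs. adjacency_mat vs E $$ (i, j)) = real (r * (k - 1))"
proof -
  define E' where "E' = {e \<in> E. vs ! i \<in> e}"
  have E': "finite E'" "card E' = r"
    using hyp reg i vs by (auto simp: E'_def hypergraph_def regular_hypergraph_def)
  \<comment> \<open>Since \<open>vs\<close> is distinct, comparing indices amounts to comparing
    vertices, so the sum can be moved to \<open>V\<close>.\<close>
  have "(\<Sum>j<length vs. adjacency_mat vs E $$ (i, j)) =
      (\<Sum>j<length vs. if vs ! i = vs ! j then 0 else real (card {e \<in> E. {vs ! i, vs ! j} \<subseteq> e}))"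
    using i vs by (auto simp: adjacency_mat_def nth_eq_iff_index_eq intro!: sum.cong)
  also have "\<dots> = (\<Sum>w\<in>V. if vs ! i = w then 0 else real (card {e \<in> E. {vs ! i, w} \<subseteq> e}))"
    by (rule sum.reindex_bij_betw[OF bij_betw_nth]) (use vs in auto)
  also have "\<dots> = (\<Sum>w\<in>V - {vs ! i}. real (card {e \<in> E'. w \<in> e}))"
    using hyp by (intro sum.mono_neutral_cong_right) (auto simp: hypergraph_def E'_def intro!: arg_cong[of _ _ card])
  also have "\<dots> = real (\<Sum>w\<in>V - {vs ! i}. card {e \<in> E'. w \<in> e})"
    by simp
  also have "(\<Sum>w\<in>V - {vs ! i}. card {e \<in> E'. w \<in> e}) = (k - 1) * card E'"
  proof (rule sum_multicount)
    show "\<forall>e\<in>E'. card {w \<in> V - {vs ! i}. w \<in> e} = k - 1"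
    proof
      fix e assume e: "e \<in> E'"
      have "{w \<in> V - {vs ! i}. w \<in> e} = e - {vs ! i}"
        using e hyp by (auto simp: E'_def hypergraph_def)
      thus "card {w \<in> V - {vs ! i}. w \<in> e} = k - 1"
        using e unif by (simp add: E'_def uniform_hypergraph_def)
    qed
  qed (use hyp E' in \<open>auto simp: hypergraph_def\<close>)
  finally show ?thesis
    by (simp add: E' mult.commute)
qed

lemma proots_prod_list_linear: "proots (\<Prod>x\<leftarrow>xs. [:- x, 1:]) = mset (xs :: 'a::idom list)"
proof (induction xs)
  case (Cons x xs)
  \<comment> \<open>The roots of a product are the union of the roots of its factors only if the
    product is nonzero.\<close>
  have "(\<Prod>x\<leftarrow>xs. [:- x, 1:]) \<noteq> 0"
    by (auto simp: prod_list_zero_iff)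
  thus ?case
    using Cons by (simp add: proots_mult del: mult_pCons_left)
qed simp

theorem theorem3p6:
  fixes V :: "'a set" and E :: "'a set set" and vs :: "'a list"
    and n k r :: nat and lam1 :: complex and lams :: "complex list"
  assumes "hypergraph V E"
    and "card V = n"
    and "uniform_hypergraph E k"
    and "regular_hypergraph V E r"
    and "distinct vs" and "set vs = V"
    and "lam1 = of_nat (r * (k - 1))"
    and "eigenvalue_mset (adjacency_mat vs E) = mset (lam1 # lams)"
  shows "eigenvalue_mset (seidel_mat vs E) =
    mset ((of_nat n - 1 - 2 * lam1) # map (\<lambda>l. - 1 - 2 * l) lams)"
proof -
  have len: "length vs = n"
    using assms(2,5,6) distinct_card by metis
  define A where "A = map_mat complex_of_real (adjacency_mat vs E)"
  define S where "S = map_mat complex_of_real (seidel_mat vs E)"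
  have A: "A \<in> carrier_mat n n" and S: "S \<in> carrier_mat n n"
    by (auto simp: A_def S_def adjacency_mat_def seidel_mat_def all_ones_mat_def len)
  have S_index: "S $$ (i, j) = 1 - (if i = j then 1 else 0) - 2 * A $$ (i, j)"
    if "i < n" "j < n" for i j
    using that by (auto simp: A_def S_def adjacency_mat_def seidel_mat_def all_ones_mat_def len)
  have A_sum: "(\<Sum>j<n. A $$ (i, j)) = lam1" if "i < n" for i
  proof -
    have "(\<Sum>j<n. A $$ (i, j)) = complex_of_real (\<Sum>j<n. adjacency_mat vs E $$ (i, j))"
      using that unfolding of_real_sum
      by (intro sum.cong) (auto simp: A_def adjacency_mat_def len)
    thus ?thesis
      using adjacency_mat_row_sum[OF assms(1,3-6), of i] that
      by (simp add: len assms(7) del: of_real_sum)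
  qed
  have S_sum: "(\<Sum>j<n. S $$ (i, j)) = of_nat n - 1 - 2 * lam1" if "i < n" for i
  proof -
    have "(\<Sum>j<n. S $$ (i, j)) = (\<Sum>j<n. 1 - (if i = j then 1 else 0) - 2 * A $$ (i, j))"
      using that by (intro sum.cong) (auto simp: S_index)
    also have "\<dots> = of_nat n - 1 - 2 * (\<Sum>j<n. A $$ (i, j))"
      using that by (simp add: sum_subtractf sum_distrib_left)
    finally show ?thesis
      by (simp add: A_sum that)
  qed
  \<comment> \<open>An empty matrix has characteristic polynomial 1 and hence no eigenvalues, but
    the given spectrum contains \<open>lam1\<close>.\<close>
  have "n \<noteq> 0"
  proof
    assume "n = 0"
    hence "degree (char_poly A) = 0"
      using degree_monic_char_poly[OF A] by simp
    hence "char_poly A = 1"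
      using degree_monic_char_poly[OF A] \<open>n = 0\<close> by (metis monic_degree_0)
    thus False
      using assms(8) by (simp add: eigenvalue_mset_def A_def)
  qed
  then obtain m where n: "n = Suc m"
    by (cases n) auto
  have D: "deflate_mat A \<in> carrier_mat m m"
    using A by (auto simp: deflate_mat_def n)
  \<comment> \<open>The constant entries of \<open>J\<close> cancel in the row differences; the
    entries of \<open>I\<close> in row 0 that are subtracted lie off the diagonal, so they are
    0.\<close>
  have DS: "deflate_mat S = (- 1) \<cdot>\<^sub>m 1\<^sub>m m + (- 2) \<cdot>\<^sub>m deflate_mat A"
    by (rule eq_matI) (use A S in \<open>auto simp: deflate_mat_def n S_index\<close>)
  obtain xs where xs: "char_poly (deflate_mat A) = (\<Prod>x\<leftarrow>xs. [:- x, 1:])"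
    using char_poly_factorized[OF D] by auto
  have "char_poly A = (\<Prod>x\<leftarrow>lam1 # xs. [:- x, 1:])"
    using char_poly_constant_row_sum[of A m lam1] A A_sum by (simp add: n xs)
  \<comment> \<open>Cancelling a single copy of \<open>lam1\<close> identifies \<open>xs\<close>
    with \<open>lams\<close> up to order, even if \<open>lam1\<close> is a multiple
    eigenvalue.\<close>
  hence "mset (lam1 # xs) = mset (lam1 # lams)"
    using assms(8) by (metis eigenvalue_mset_def A_def proots_prod_list_linear)
  hence mset_xs: "mset xs = mset lams"
    by simp
  have "char_poly S = [:- (of_nat n - 1 - 2 * lam1), 1:] * char_poly (deflate_mat S)"
    using char_poly_constant_row_sum[of S m "of_nat n - 1 - 2 * lam1"] S S_sum unfolding n by blast
  also have "\<dots> = (\<Prod>x\<leftarrow>(of_nat n - 1 - 2 * lam1) # map (\<lambda>l. - 1 - 2 * l) xs. [:- x, 1:])"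
    unfolding DS char_poly_affine[OF D xs] by (simp add: o_def)
  finally have "eigenvalue_mset (seidel_mat vs E) =
      mset ((of_nat n - 1 - 2 * lam1) # map (\<lambda>l. - 1 - 2 * l) xs)"
    unfolding eigenvalue_mset_def S_def[symmetric] by (simp only: proots_prod_list_linear)
  thus ?thesis
    by (simp add: mset_xs)
qed

end
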